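(* The following graphs have admissible labelings: (1) any path $P_d$; (2) any cycle $C_d$; (3) any complete graph $K_d$; (4) any graph which is totally disconnected, i.e., just a set of discrete points; (5) any star graph.
   Context: Graphs are finite, simple, undirected and have at least one vertex. $P_{n-1}$ is the path on $n$ vertices, $C_n$ is the cycle on $n\geq 3$ vertices, $K_n$ is the complete graph on $n\geq 1$ vertices, and the star graph on $d\geq 2$ vertices is the complete bipartite graph $K_{1,d-1}$. Let $G$ be a graph with vertex set $V=\{v_1,\ldots,v_d\}$, $d=|V|$. For positive integers $n,s$ write $[n]=\{1,\ldots,n\}$ and let $\binom{[n]}{s}$ be the set of subsets of $[n]$ of cardinality $s$. An admissible labeling of $G$ is an injective function $\phi\colon V\to\binom{[n]}{s}$, for some choice of $n$ and $s$, such that (1) $\phi(v_1)\cup\cdots\cup\phi(v_d)=[n]$, and (2) for all vertices $v,w$, $v$ is adjacent to $w$ in $G$ if and only if $|\phi(v)\cap\phi(w)|=s-1$ (equivalently, $|\phi(v)\cup\phi(w)|=s+1$). *)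

theory Defs
  imports "Graph_Theory.Kuratowski" "HOL-Library.Ramsey"
begin

text \<open>
  A finite simple undirected graph is a \<^locale>\<open>graph\<close> of the AFP entry Graph_Theory: a finite,
  loop-free, symmetric digraph without parallel arcs. Adjacency of \<open>v\<close> and \<open>w\<close> is
  \<open>v \<rightarrow>\<^bsub>G\<^esub> w\<close>. As with \<^const>\<open>complete_digraph\<close> and \<^const>\<open>complete_bipartite_digraph\<close>,
  the named graphs below are predicates that are closed under isomorphism.
\<close>

text \<open>
  \<open>P\<^sub>k\<close> is indexed by its number of edges, so it has \<open>k + 1\<close> vertices; \<open>P\<^sub>0\<close> is a single vertex.
\<close>

definition path_graph :: "nat \<Rightarrow> ('a, 'b) pre_digraph \<Rightarrow> bool" where
  "path_graph k G \<longleftrightarrow> graph G \<and>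
     (\<exists>f. bij_betw f {0..k} (verts G) \<and>
          arcs_ends G = {(f i, f j) | i j. i \<le> k \<and> j \<le> k \<and> (j = Suc i \<or> i = Suc j)})"

definition cycle_graph :: "nat \<Rightarrow> ('a, 'b) pre_digraph \<Rightarrow> bool" where
  "cycle_graph n G \<longleftrightarrow> graph G \<and> n \<ge> 3 \<and>
     (\<exists>f. bij_betw f {0..<n} (verts G) \<and>
          arcs_ends G = {(f i, f j) | i j. i < n \<and> j < n \<and>
                           (j = Suc i mod n \<or> i = Suc j mod n)})"

definition totally_disconnected :: "('a, 'b) pre_digraph \<Rightarrow> bool" where
  "totally_disconnected G \<longleftrightarrow> graph G \<and> arcs_ends G = {}"

definition star_graph :: "nat \<Rightarrow> ('a, 'b) pre_digraph \<Rightarrow> bool" where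
  "star_graph d G \<longleftrightarrow> d \<ge> 2 \<and> complete_bipartite_digraph 1 (d - 1) G"

text \<open>
  \<^term>\<open>nsets {1..n} s\<close> is the set of \<open>s\<close>-element subsets of \<open>{1..n}\<close>. Since \<open>s > 0\<close>, the
  natural-number subtraction \<open>s - 1\<close> does not truncate.
\<close>

definition admissible_labeling ::
  "('a, 'b) pre_digraph \<Rightarrow> nat \<Rightarrow> nat \<Rightarrow> ('a \<Rightarrow> nat set) \<Rightarrow> bool" where
  "admissible_labeling G n s \<phi> \<longleftrightarrow>
     n > 0 \<and> s > 0 \<and>
     \<phi> \<in> verts G \<rightarrow> nsets {1..n} s \<and>
     inj_on \<phi> (verts G) \<and>
     (\<Union>v\<in>verts G. \<phi> v) = {1..n} \<and>
     (\<forall>v\<in>verts G. \<forall>w\<in>verts G. v \<rightarrow>\<^bsub>G\<^esub> w \<longleftrightarrow> card (\<phi> v \<inter> \<phi> w) = s - 1)"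

definition has_admissible_labeling :: "('a, 'b) pre_digraph \<Rightarrow> bool" where
  "has_admissible_labeling G \<longleftrightarrow> (\<exists>n s \<phi>. admissible_labeling G n s \<phi>)"

end

theory Submission
  imports Defs
begin

text \<open>
  Which elements the labels consist of is irrelevant: a label set of any type can be renumbered by
  \<open>1, \<dots>, n\<close>, and only the sizes of labels and of their intersections matter. So it is enough to
  assign to each vertex a set of a fixed positive size such that distinct vertices get distinct sets,
  and these sets share all but one element exactly when the vertices are adjacent
  (\<open>has_admissible_labelingI\<close>). With this freedom each family has a natural choice of elements.

  \<^item> In a path or a cycle, the \<open>i\<close>-th vertex gets the pair formed by \<open>i\<close> and the index after it,
    as if it were an edge: a path is the line graph of a path with one more vertex, and a
    cycle is its own line graph.
  \<^item> In a complete graph each vertex gets the singleton of itself, so that \<open>s - 1 = 0\<close> and disjoint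
    labels are adjacent.
  \<^item> In a totally disconnected graph each vertex gets two private elements, so that disjoint labels
    are not adjacent.
  \<^item> In a star the centre is labelled by the set of all leaves, and each leaf exchanges itself in
    this set for a private new element. One exchange separates a leaf from the centre, but
    two leaves miss two different elements of the centre's label and share only \<open>s - 2\<close> elements.
\<close>

text \<open>
  The labels are pulled back along \<open>f\<close> and pushed forward along a bijection of their union
  with an initial segment; injectivity of the latter preserves all cardinalities. The condition on
  the diagonal is automatic: a graph has no loops, and a label meets itself in \<open>s \<noteq> s - 1\<close> elements.
\<close>

lemma has_admissible_labelingI:
  fixes G :: "('a, 'b) pre_digraph" and \<psi> :: "'i \<Rightarrow> 'c set"
  assumes G: "graph G" "verts G \<noteq> {}"
    and f: "bij_betw f I (verts G)"
    and s: "s > 0"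
    and card: "\<And>i. i \<in> I \<Longrightarrow> card (\<psi> i) = s"
    and inj: "inj_on \<psi> I"
    and adj: "\<And>i j. i \<in> I \<Longrightarrow> j \<in> I \<Longrightarrow> i \<noteq> j \<Longrightarrow>
                f i \<rightarrow>\<^bsub>G\<^esub> f j \<longleftrightarrow> card (\<psi> i \<inter> \<psi> j) = s - 1"
  shows "has_admissible_labeling G"
proof -
  interpret graph G by fact
  define U where "U = (\<Union>i\<in>I. \<psi> i)"
  have finI: "finite I" "I \<noteq> {}"
    using f G(2) bij_betw_finite[OF f] by (auto simp: bij_betw_def)
  have fin: "finite (\<psi> i)" if "i \<in> I" for i
    using card[OF that] s by (auto intro: card_ge_0_finite)
  have finU: "finite U"
    unfolding U_def using finI fin by blast
  obtain h where h: "bij_betw h U {1..card U}"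
    using ex_bij_betw_nat_finite_1[OF finU] bij_betw_inv by blast
  have injU: "inj_on h U" and imU: "h ` U = {1..card U}"
    using h by (auto simp: bij_betw_def)
  have sub: "\<psi> i \<subseteq> U" if "i \<in> I" for i
    using that by (auto simp: U_def)
  have U0: "card U > 0"
    using finI card s sub finU by (metis card_gt_0_iff card_mono ex_in_conv less_le_trans)
  define g where "g = inv_into I f"
  have g: "g v \<in> I" "f (g v) = v" if "v \<in> verts G" for v
    using that f by (auto simp: g_def bij_betw_def inv_into_into f_inv_into_f)
  have gi: "inj_on g (verts G)"
    using g by (metis inj_onI)
  have gim: "g ` verts G = I"
    using bij_betw_inv_into[OF f] by (simp add: g_def bij_betw_def)
  define \<phi> where "\<phi> v = h ` \<psi> (g v)" for v
  have "\<phi> \<in> verts G \<rightarrow> nsets {1..card U} s"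
  proof
    fix v assume v: "v \<in> verts G"
    have "h ` \<psi> (g v) \<subseteq> {1..card U}"
      using sub[OF g(1)[OF v]] imU by blast
    moreover have "card (h ` \<psi> (g v)) = s"
      using card_image[OF inj_on_subset[OF injU sub[OF g(1)[OF v]]]] card[OF g(1)[OF v]] by simp
    ultimately show "\<phi> v \<in> nsets {1..card U} s"
      using fin[OF g(1)[OF v]] by (simp add: \<phi>_def nsets_def)
  qed
  moreover have "inj_on \<phi> (verts G)"
  proof (rule inj_onI)
    fix v w assume vw: "v \<in> verts G" "w \<in> verts G" "\<phi> v = \<phi> w"
    then have "\<psi> (g v) = \<psi> (g w)"
      using inj_on_image_eq_iff[OF injU sub sub] g by (simp add: \<phi>_def)
    then show "v = w"
      using inj gi g vw by (metis inj_onD)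
  qed
  moreover have "(\<Union>v\<in>verts G. \<phi> v) = {1..card U}"
  proof -
    have "(\<Union>v\<in>verts G. \<phi> v) = h ` (\<Union>i\<in>g ` verts G. \<psi> i)"
      by (auto simp: \<phi>_def)
    then show ?thesis
      using imU gim by (simp add: U_def)
  qed
  moreover have "v \<rightarrow>\<^bsub>G\<^esub> w \<longleftrightarrow> card (\<phi> v \<inter> \<phi> w) = s - 1"
    if v: "v \<in> verts G" and w: "w \<in> verts G" for v w
  proof -
    have "\<phi> v \<inter> \<phi> w = h ` (\<psi> (g v) \<inter> \<psi> (g w))"
      using inj_on_image_Int[OF injU sub sub] g v w by (simp add: \<phi>_def)
    moreover have "inj_on h (\<psi> (g v) \<inter> \<psi> (g w))"
      using inj_on_subset[OF injU] sub g v by blast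
    ultimately have eq: "card (\<phi> v \<inter> \<phi> w) = card (\<psi> (g v) \<inter> \<psi> (g w))"
      by (simp add: card_image)
    show ?thesis
    proof (cases "v = w")
      case True
      then show ?thesis
        using eq card g v s adj_not_same by fastforce
    next
      case False
      then show ?thesis
        using eq adj[of "g v" "g w"] g v w by metis
    qed
  qed
  ultimately have "admissible_labeling G (card U) s \<phi>"
    using U0 s by (auto simp: admissible_labeling_def)
  then show ?thesis
    unfolding has_admissible_labeling_def by blast
qed

text \<open>
  Paths and cycles are treated at once: both join each index to its successor, and differ
  only in whether the successor wraps around. The labels are the pairs \<open>{i, next i}\<close>; two of them
  meet exactly when one index is the successor of the other. The successor function
  must not have a cycle of length two, for then two vertices would get the same pair.
\<close>

lemma has_admissible_labeling_successor:
  fixes G :: "('a, 'b) pre_digraph" and nxt :: "'i \<Rightarrow> 'i"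
  assumes G: "graph G" "verts G \<noteq> {}"
    and f: "bij_betw f I (verts G)"
    and arcs: "arcs_ends G = {(f i, f j) | i j. i \<in> I \<and> j \<in> I \<and> (j = nxt i \<or> i = nxt j)}"
    and inj: "inj_on nxt I"
    and nxt: "\<And>i. i \<in> I \<Longrightarrow> nxt i \<noteq> i"
    and nxt2: "\<And>i. i \<in> I \<Longrightarrow> nxt (nxt i) \<noteq> i"
  shows "has_admissible_labeling G"
proof (rule has_admissible_labelingI[OF G f])
  show "(2::nat) > 0" by simp
  show "card {i, nxt i} = 2" if "i \<in> I" for i
    using nxt[OF that] by auto
  show "inj_on (\<lambda>i. {i, nxt i}) I"
    using nxt2 unfolding inj_on_def doubleton_eq_iff by metis
  fix i j assume ij: "i \<in> I" "j \<in> I" "i \<noteq> j"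
  have "f i \<rightarrow>\<^bsub>G\<^esub> f j \<longleftrightarrow> j = nxt i \<or> i = nxt j"
    using f ij unfolding arcs bij_betw_def inj_on_def by blast
  also have "\<dots> \<longleftrightarrow> card ({i, nxt i} \<inter> {j, nxt j}) = 2 - 1"
  proof -
    have "nxt i \<noteq> nxt j"
      using inj ij by (auto dest: inj_onD)
    moreover have "j \<noteq> nxt i \<or> i \<noteq> nxt j"
      using ij nxt2 by metis
    ultimately have "{i, nxt i} \<inter> {j, nxt j} =
        (if j = nxt i then {j} else if i = nxt j then {i} else {})"
      using ij(3) by auto
    then show ?thesis by simp
  qed
  finally show "f i \<rightarrow>\<^bsub>G\<^esub> f j \<longleftrightarrow> card ({i, nxt i} \<inter> {j, nxt j}) = 2 - 1" .
qed

lemma path_graph_has_admissible_labeling: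
  assumes "path_graph k G"
  shows "has_admissible_labeling G"
proof -
  obtain f where f: "graph G" "bij_betw f {0..k} (verts G)"
    "arcs_ends G = {(f i, f j) | i j. i \<le> k \<and> j \<le> k \<and> (j = Suc i \<or> i = Suc j)}"
    using assms unfolding path_graph_def by blast
  have "verts G \<noteq> {}"
    using f(2) by (auto simp: bij_betw_def)
  then show ?thesis
    using has_admissible_labeling_successor[of G f "{0..k}" Suc] f by simp
qed

lemma cycle_graph_has_admissible_labeling:
  assumes "cycle_graph n G"
  shows "has_admissible_labeling G"
proof -
  obtain f where f: "graph G" "n \<ge> 3" "bij_betw f {0..<n} (verts G)"
    "arcs_ends G = {(f i, f j) | i j. i < n \<and> j < n \<and> (j = Suc i mod n \<or> i = Suc j mod n)}"
    using assms unfolding cycle_graph_def by blast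
  have "verts G \<noteq> {}"
    using f(2,3) by (auto simp: bij_betw_def)
  moreover have "inj_on (\<lambda>i. Suc i mod n) {0..<n}"
    by (auto simp: inj_on_def mod_Suc split: if_splits)
  moreover have "Suc i mod n \<noteq> i" "Suc (Suc i mod n) mod n \<noteq> i" if "i < n" for i
    using that f(2) by (auto simp: mod_Suc split: if_splits)
  ultimately show ?thesis
    using has_admissible_labeling_successor[of G f "{0..<n}" "\<lambda>i. Suc i mod n"] f by simp
qed

lemma complete_digraph_has_admissible_labeling:
  assumes "complete_digraph d G" and "verts G \<noteq> {}"
  shows "has_admissible_labeling G"
proof -
  have G: "graph G" "arcs_ends G = {(u, v). (u, v) \<in> verts G \<times> verts G \<and> u \<noteq> v}"
    using assms(1) by (auto simp: complete_digraph_def)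
  show ?thesis
    by (rule has_admissible_labelingI[OF G(1) assms(2) bij_betw_id, where \<psi> = "\<lambda>v. {v}" and s = 1])
       (auto simp: G(2))
qed

lemma totally_disconnected_has_admissible_labeling:
  fixes G :: "('a, 'b) pre_digraph"
  assumes "totally_disconnected G" and "verts G \<noteq> {}"
  shows "has_admissible_labeling G"
proof -
  have G: "graph G" "arcs_ends G = {}"
    using assms(1) by (auto simp: totally_disconnected_def)
  let ?\<psi> = "\<lambda>v::'a. {v} \<times> (UNIV :: bool set)"
  have disj: "?\<psi> v \<inter> ?\<psi> w = {}" if "v \<noteq> w" for v w
    using that by auto
  show ?thesis
    by (rule has_admissible_labelingI[OF G(1) assms(2) bij_betw_id, where \<psi> = ?\<psi> and s = 2])
       (use disj in \<open>auto simp: G(2) inj_on_def card_cartesian_product\<close>)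
qed

lemma star_graph_has_admissible_labeling:
  fixes G :: "('a, 'b) pre_digraph"
  assumes "star_graph d G"
  shows "has_admissible_labeling G"
proof -
  from assms obtain C L where G: "graph G" "d \<ge> 2" "verts G = C \<union> L" "C \<inter> L = {}"
    "card C = 1" "card L = d - 1" "arcs_ends G = C \<times> L \<union> L \<times> C"
    unfolding star_graph_def complete_bipartite_digraph_def by blast
  obtain c where c: "C = {c}"
    using G(5) card_1_singletonE by blast
  have cL: "c \<notin> L" and L: "card L > 0"
    using G(2,4,6) c by auto
  have finL: "finite L"
    using L by (rule card_ge_0_finite)
  define \<psi> :: "'a \<Rightarrow> ('a + 'a) set"
    where "\<psi> v = (if v = c then Inl ` L else insert (Inr v) (Inl ` (L - {v})))" for v
  have Inl: "card (Inl ` A :: ('a + 'a) set) = card A" for A :: "'a set"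
    by (simp add: card_image)
  have leaf: "\<psi> v = insert (Inr v) (Inl ` (L - {v}))" if "v \<in> L" for v
    using that cL by (auto simp: \<psi>_def)
  have centre: "\<psi> c = Inl ` L"
    by (simp add: \<psi>_def)
  have centre_leaf: "card (\<psi> c \<inter> \<psi> v) = card L - 1" "card (\<psi> v \<inter> \<psi> c) = card L - 1"
    if "v \<in> L" for v
  proof -
    have "\<psi> c \<inter> \<psi> v = Inl ` (L - {v})"
      using that by (auto simp: leaf centre)
    then show "card (\<psi> c \<inter> \<psi> v) = card L - 1"
      using that finL by (simp add: Inl)
    then show "card (\<psi> v \<inter> \<psi> c) = card L - 1"
      by (simp add: Int_commute)
  qed
  have leaf_leaf: "card (\<psi> v \<inter> \<psi> w) \<noteq> card L - 1" if "v \<in> L" "w \<in> L" "v \<noteq> w" for v w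
  proof -
    have "\<psi> v \<inter> \<psi> w = Inl ` (L - {v, w})"
      using that by (auto simp: leaf)
    then have "card (\<psi> v \<inter> \<psi> w) = card L - 2"
      using that finL by (simp add: Inl card_Diff_subset)
    \<comment> \<open>Two distinct leaves give \<open>card L \<ge> 2\<close>, which rules out truncation in \<open>card L - 2\<close>.\<close>
    moreover have "card L \<ge> 2"
      using card_mono[OF finL, of "{v, w}"] that by simp
    ultimately show ?thesis by simp
  qed
  show ?thesis
  proof (rule has_admissible_labelingI[OF G(1) _ bij_betw_id, where \<psi> = \<psi> and s = "card L"])
    show "verts G \<noteq> {}" using G(3) c by simp
    show "card L > 0" by fact
    show "card (\<psi> v) = card L" if "v \<in> verts G" for v
    proof (cases "v = c")
      case True
      then show ?thesis by (simp add: centre Inl)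
    next
      case False
      then have "v \<in> L"
        using that G(3) c by auto
      moreover have "Inr v \<notin> Inl ` (L - {v})"
        by auto
      ultimately show ?thesis
        using L finL by (simp add: leaf Inl)
    qed
    show "inj_on \<psi> (verts G)"
    proof (rule inj_onI)
      fix v w assume "\<psi> v = \<psi> w"
      moreover have "Inr u \<in> \<psi> x \<longleftrightarrow> u = x \<and> x \<noteq> c" for u x
        by (auto simp: \<psi>_def)
      ultimately show "v = w" by metis
    qed
    show "id v \<rightarrow>\<^bsub>G\<^esub> id w \<longleftrightarrow> card (\<psi> v \<inter> \<psi> w) = card L - 1"
      if "v \<in> verts G" "w \<in> verts G" "v \<noteq> w" for v w
      using that cL centre_leaf leaf_leaf by (auto simp: G(3,7) c)
  qed
qed

theorem proposition5p16:
  fixes G :: "('a, 'b) pre_digraph"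
  assumes "graph G" and "verts G \<noteq> {}"
  shows "(\<forall>d. path_graph d G \<longrightarrow> has_admissible_labeling G) \<and>
         (\<forall>d. cycle_graph d G \<longrightarrow> has_admissible_labeling G) \<and>
         (\<forall>d. complete_digraph d G \<longrightarrow> has_admissible_labeling G) \<and>
         (totally_disconnected G \<longrightarrow> has_admissible_labeling G) \<and>
         (\<forall>d. star_graph d G \<longrightarrow> has_admissible_labeling G)"
  using assms(2) path_graph_has_admissible_labeling cycle_graph_has_admissible_labeling
    complete_digraph_has_admissible_labeling totally_disconnected_has_admissible_labeling
    star_graph_has_admissible_labeling
  by blast

end
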